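(* Let $(\mathfrak{g},[~,~]_\mathfrak{g},\alpha)$ and $(\mathfrak{h},[~,~]_\mathfrak{h},\beta)$ be two (multiplicative) Hom-Lie algebras over $\mathbf{k}$, let $\lambda\in\mathbf{k}$, and let $R:\mathfrak{h}\to\mathfrak{g}$ be a relative Rota-Baxter operator of weight $\lambda$ with respect to a given Hom-Lie algebra action $\diamond:\mathfrak{g}\times\mathfrak{h}\to\mathfrak{h}$. Define a bilinear map $$\widetilde\diamond:\mathfrak{h}\times\mathfrak{g}\to\mathfrak{g},\qquad h\,\widetilde\diamond\,x:=[R(h),x]_\mathfrak{g}+R(x\diamond h),\quad h\in\mathfrak{h},\ x\in\mathfrak{g}.$$ Then $(\mathfrak{g},\widetilde\diamond,\alpha)$ is a representation of the induced Hom-Lie algebra $(\mathfrak{h},[~,~]_\mathfrak{h}^R,\beta)$, where $[h,k]_\mathfrak{h}^R=R(h)\diamond k-R(k)\diamond h+\lambda[h,k]_\mathfrak{h}$. Moreover, the cohomology groups of the induced Hom-Lie algebra $(\mathfrak{h},[~,~]_\mathfrak{h}^R,\beta)$ with coefficients in this representation are isomorphic to the cohomology groups of the operator $R$.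
   Context: All vector spaces and (multi)linear maps are over a field $\mathbf{k}$ of characteristic $0$. A (multiplicative) Hom-Lie algebra $(\mathfrak{g},[~,~],\alpha)$ is a vector space $\mathfrak{g}$ with a skew-symmetric bilinear map $[~,~]$ and a linear map $\alpha:\mathfrak{g}\to\mathfrak{g}$ such that $[\alpha(x),[y,z]]+[\alpha(y),[z,x]]+[\alpha(z),[x,y]]=0$ and $\alpha([x,y])=[\alpha(x),\alpha(y)]$. A representation of it is a triple $(V,\diamond,\beta)$ with $V$ a vector space, $\diamond:\mathfrak{g}\times V\to V$ bilinear, $\beta:V\to V$ linear, $\beta(x\diamond v)=\alpha(x)\diamond\beta(v)$ and $[x,y]\diamond\beta(v)=\alpha(x)\diamond(y\diamond v)-\alpha(y)\diamond(x\diamond v)$. Its cohomology with coefficients in $V$ is that of the complex $C^0_{\mathrm{Hom}}(\mathfrak{g},V)=\{v\in V\mid\beta(v)=v\}$, $C^n_{\mathrm{Hom}}(\mathfrak{g},V)=\{f:\wedge^n\mathfrak{g}\to V\mid\beta\circ f=f\circ\alpha^{\wedge n}\}$ ($n\ge1$), with $\delta_{\mathrm{Hom}}(v)(x)=x\diamond v$ and $$(\delta_{\mathrm{Hom}}f)(x_1,\ldots,x_{n+1})=\sum_{i=1}^{n+1}(-1)^{i+1}\alpha^{n-1}(x_i)\diamond f(x_1,\ldots,\widehat{x_i},\ldots,x_{n+1})+\sum_{i<j}(-1)^{i+j}f([x_i,x_j],\alpha(x_1),\ldots,\widehat{\alpha(x_i)},\ldots,\widehat{\alpha(x_j)},\ldots,\alpha(x_{n+1})).$$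 A Hom-Lie algebra action of $(\mathfrak{g},[~,~]_\mathfrak{g},\alpha)$ on $(\mathfrak{h},[~,~]_\mathfrak{h},\beta)$ is a bilinear map $\diamond:\mathfrak{g}\times\mathfrak{h}\to\mathfrak{h}$ making $(\mathfrak{h},\diamond,\beta)$ a representation of $\mathfrak{g}$ and satisfying $\alpha(x)\diamond[h,k]_\mathfrak{h}=[x\diamond h,\beta(k)]_\mathfrak{h}+[\beta(h),x\diamond k]_\mathfrak{h}$. A linear map $R:\mathfrak{h}\to\mathfrak{g}$ is a relative Rota-Baxter operator of weight $\lambda$ if $\alpha\circ R=R\circ\beta$ and $[R(h),R(k)]_\mathfrak{g}=R\big(R(h)\diamond k-R(k)\diamond h+\lambda[h,k]_\mathfrak{h}\big)$; in that case $(\mathfrak{h},[~,~]_\mathfrak{h}^R,\beta)$ is a Hom-Lie algebra (the induced Hom-Lie algebra). Cohomology of $R$: let $C^0_{\mathrm{Hom}}(\mathfrak{h},\mathfrak{g})=\{x\in\mathfrak{g}\mid\alpha(x)=x\}$ and $C^n_{\mathrm{Hom}}(\mathfrak{h},\mathfrak{g})=\{f:\wedge^n\mathfrak{h}\to\mathfrak{g}\mid\alpha\circ f=f\circ\beta^{\wedge n}\}$ for $n\ge1$. With $Sh(m,n)$ the set of $(m,n)$-shuffles, for $f\in C^m_{\mathrm{Hom}}(\mathfrak{h},\mathfrak{h})=\{f:\wedge^m\mathfrak{h}\to\mathfrak{h}\mid\beta\circ f=f\circ\beta^{\wedge m}\}$ and $P\in C^n_{\mathrm{Hom}}(\mathfrak{h},\mathfrak{g})$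 ($m,n\ge1$) set $$(\widetilde{i}_fP)(h_1,\ldots,h_{m+n-1})=\sum_{\sigma\in Sh(m,n-1)}(-1)^\sigma P\big(f(h_{\sigma(1)},\ldots,h_{\sigma(m)}),\beta^{m-1}h_{\sigma(m+1)},\ldots,\beta^{m-1}h_{\sigma(m+n-1)}\big),$$ $$(\widetilde\theta P)(h_1,\ldots,h_{n+1})=\sum_{i=1}^{n+1}(-1)^{n+i}P(h_1,\ldots,\widehat{h_i},\ldots,h_{n+1})\diamond\beta^{n-1}(h_i),$$ and for $P\in C^m_{\mathrm{Hom}}(\mathfrak{h},\mathfrak{g})$, $Q\in C^n_{\mathrm{Hom}}(\mathfrak{h},\mathfrak{g})$ ($m,n\ge1$) set $[P,Q]_{\mathsf{D}}^\sim=[P,Q]_{\mathsf{C}}+\widetilde{i}_{\widetilde\theta P}Q-(-1)^{mn}\widetilde{i}_{\widetilde\theta Q}P$, where $$[P,Q]_{\mathsf{C}}(h_1,\ldots,h_{m+n})=\sum_{\sigma\in Sh(m,n)}(-1)^\sigma[\alpha^{n-1}P(h_{\sigma(1)},\ldots,h_{\sigma(m)}),\alpha^{m-1}Q(h_{\sigma(m+1)},\ldots,h_{\sigma(m+n)})]_\mathfrak{g}.$$ Also let $$(\widetilde{d}_\lambda f)(h_1,\ldots,h_{n+1})=\lambda\sum_{i<j}(-1)^{i+j}f([h_i,h_j]_\mathfrak{h},\beta(h_1),\ldots,\widehat{\beta(h_i)},\ldots,\widehat{\beta(h_j)},\ldots,\beta(h_{n+1})).$$ The cohomology groups of the operator $R$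 are those of the complex $\{C^\bullet_{\mathrm{Hom}}(\mathfrak{h},\mathfrak{g}),D_R\}$, where $D_R(f)=\widetilde{d}_\lambda(f)+[R,f]_{\mathsf{D}}^\sim$ for $f\in C^n_{\mathrm{Hom}}(\mathfrak{h},\mathfrak{g})$, $n\ge1$, and $D_R(x)(h)=[R(h),x]_\mathfrak{g}+R(x\diamond h)$ for $x\in C^0_{\mathrm{Hom}}(\mathfrak{h},\mathfrak{g})$. *)

theory Defs
  imports Complex_Main "HOL-Algebra.Coset" "HOL-Combinatorics.Permutations"
begin

section \<open>Hom-Lie algebras, representations, actions\<close>

definition bilinear_map ::
  "('k::field \<Rightarrow> 'a::ab_group_add \<Rightarrow> 'a) \<Rightarrow> ('k \<Rightarrow> 'b::ab_group_add \<Rightarrow> 'b) \<Rightarrow>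
   ('k \<Rightarrow> 'c::ab_group_add \<Rightarrow> 'c) \<Rightarrow> ('a \<Rightarrow> 'b \<Rightarrow> 'c) \<Rightarrow> bool" where
  "bilinear_map sa sb sc f \<longleftrightarrow>
     (\<forall>y. Vector_Spaces.linear sa sc (\<lambda>x. f x y)) \<and> (\<forall>x. Vector_Spaces.linear sb sc (f x))"

locale hom_lie_algebra = vector_space scale
  for scale :: "'k::field_char_0 \<Rightarrow> 'g::ab_group_add \<Rightarrow> 'g" +
  fixes bracket :: "'g \<Rightarrow> 'g \<Rightarrow> 'g"
    and twist :: "'g \<Rightarrow> 'g"
  assumes bracket_bilinear: "bilinear_map scale scale scale bracket"
    and twist_linear: "Vector_Spaces.linear scale scale twist"
    and bracket_skew: "bracket x y = - bracket y x"
    and hom_jacobi: "bracket (twist x) (bracket y z) + bracket (twist y) (bracket z x)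
                       + bracket (twist z) (bracket x y) = 0"
    and twist_bracket: "twist (bracket x y) = bracket (twist x) (twist y)"

locale hom_lie_representation =
  alg: hom_lie_algebra scale_g bracket \<alpha> + vec: vector_space scale_v
  for scale_g :: "'k::field_char_0 \<Rightarrow> 'g::ab_group_add \<Rightarrow> 'g"
    and bracket :: "'g \<Rightarrow> 'g \<Rightarrow> 'g"
    and \<alpha> :: "'g \<Rightarrow> 'g"
    and scale_v :: "'k \<Rightarrow> 'v::ab_group_add \<Rightarrow> 'v" +
  fixes act :: "'g \<Rightarrow> 'v \<Rightarrow> 'v"
    and \<beta> :: "'v \<Rightarrow> 'v"
  assumes act_bilinear: "bilinear_map scale_g scale_v scale_v act"
    and twist_v_linear: "Vector_Spaces.linear scale_v scale_v \<beta>"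
    and twist_act: "\<beta> (act x v) = act (\<alpha> x) (\<beta> v)"
    and bracket_act: "act (bracket x y) (\<beta> v) = act (\<alpha> x) (act y v) - act (\<alpha> y) (act x v)"

locale hom_lie_action =
  hom_lie_representation scale_g bracket_g \<alpha> scale_h act \<beta> +
  target: hom_lie_algebra scale_h bracket_h \<beta>
  for scale_g :: "'k::field_char_0 \<Rightarrow> 'g::ab_group_add \<Rightarrow> 'g"
    and bracket_g :: "'g \<Rightarrow> 'g \<Rightarrow> 'g"
    and \<alpha> :: "'g \<Rightarrow> 'g"
    and scale_h :: "'k \<Rightarrow> 'h::ab_group_add \<Rightarrow> 'h"
    and bracket_h :: "'h \<Rightarrow> 'h \<Rightarrow> 'h"
    and \<beta> :: "'h \<Rightarrow> 'h"
    and act :: "'g \<Rightarrow> 'h \<Rightarrow> 'h" +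
  assumes act_bracket:
    "act (\<alpha> x) (bracket_h h k) = bracket_h (act x h) (\<beta> k) + bracket_h (\<beta> h) (act x k)"

definition induced_bracket ::
  "('k \<Rightarrow> 'h::ab_group_add \<Rightarrow> 'h) \<Rightarrow> ('h \<Rightarrow> 'h \<Rightarrow> 'h) \<Rightarrow> ('g \<Rightarrow> 'h \<Rightarrow> 'h) \<Rightarrow> 'k \<Rightarrow> ('h \<Rightarrow> 'g)
   \<Rightarrow> 'h \<Rightarrow> 'h \<Rightarrow> 'h" where
  "induced_bracket scale_h bracket_h act lam R h k =
     act (R h) k - act (R k) h + scale_h lam (bracket_h h k)"

locale relative_rota_baxter =
  hom_lie_action scale_g bracket_g \<alpha> scale_h bracket_h \<beta> act
  for scale_g :: "'k::field_char_0 \<Rightarrow> 'g::ab_group_add \<Rightarrow> 'g"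
    and bracket_g :: "'g \<Rightarrow> 'g \<Rightarrow> 'g"
    and \<alpha> :: "'g \<Rightarrow> 'g"
    and scale_h :: "'k \<Rightarrow> 'h::ab_group_add \<Rightarrow> 'h"
    and bracket_h :: "'h \<Rightarrow> 'h \<Rightarrow> 'h"
    and \<beta> :: "'h \<Rightarrow> 'h"
    and act :: "'g \<Rightarrow> 'h \<Rightarrow> 'h" +
  fixes lam :: 'k
    and R :: "'h \<Rightarrow> 'g"
  assumes R_linear: "Vector_Spaces.linear scale_h scale_g R"
    and R_twist: "\<alpha> (R h) = R (\<beta> h)"
    and R_bracket:
      "bracket_g (R h) (R k) = R (act (R h) k - act (R k) h + scale_h lam (bracket_h h k))"

definition induced_action ::
  "('g::ab_group_add \<Rightarrow> 'g \<Rightarrow> 'g) \<Rightarrow> ('g \<Rightarrow> 'h \<Rightarrow> 'h) \<Rightarrow> ('h \<Rightarrow> 'g) \<Rightarrow> 'h \<Rightarrow> 'g \<Rightarrow> 'g" where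
  "induced_action bracket_g act R h x = bracket_g (R h) x + R (act x h)"


section \<open>Cochains\<close>

text \<open>
  An \<open>n\<close>-cochain is a function on argument lists which is normalised to be \<open>0\<close> on lists of
  length other than \<open>n\<close>, so that equality of cochains is equality of alternating \<open>n\<close>-linear
  maps.  A \<open>0\<close>-cochain \<open>f\<close> is the vector \<open>f []\<close>; for \<open>n = 0\<close> the conditions
  reduce to \<open>twist_v (f []) = f []\<close>.  List positions count from \<open>0\<close>, so the
  usual \<open>x\<^sub>i\<close> is \<open>xs ! (i - 1)\<close> and signs are shifted accordingly (a sign with exponent
  \<open>i + j\<close> is unaffected).
  The hatted argument lists are written as \<open>nths xs (- {i})\<close> and \<open>nths xs (- {i, j})\<close>.
\<close>

definition alternating_multilinear ::
  "('k::field \<Rightarrow> 'a::ab_group_add \<Rightarrow> 'a) \<Rightarrow> ('k \<Rightarrow> 'v::ab_group_add \<Rightarrow> 'v) \<Rightarrow> nat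
   \<Rightarrow> ('a list \<Rightarrow> 'v) \<Rightarrow> bool" where
  "alternating_multilinear scale_a scale_v n f \<longleftrightarrow>
     (\<forall>xs i. length xs = n \<longrightarrow> i < n \<longrightarrow>
        Vector_Spaces.linear scale_a scale_v (\<lambda>x. f (xs[i := x]))) \<and>
     (\<forall>xs. length xs = n \<longrightarrow> \<not> distinct xs \<longrightarrow> f xs = 0)"

definition hom_cochains ::
  "('k::field \<Rightarrow> 'a::ab_group_add \<Rightarrow> 'a) \<Rightarrow> ('a \<Rightarrow> 'a) \<Rightarrow>
   ('k \<Rightarrow> 'v::ab_group_add \<Rightarrow> 'v) \<Rightarrow> ('v \<Rightarrow> 'v) \<Rightarrow> nat \<Rightarrow> ('a list \<Rightarrow> 'v) set" where
  "hom_cochains scale_a twist_a scale_v twist_v n =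
     {f. alternating_multilinear scale_a scale_v n f \<and>
         (\<forall>xs. length xs = n \<longrightarrow> twist_v (f xs) = f (map twist_a xs)) \<and>
         (\<forall>xs. length xs \<noteq> n \<longrightarrow> f xs = 0)}"

definition bracket_sum ::
  "('k::field \<Rightarrow> 'v::ab_group_add \<Rightarrow> 'v) \<Rightarrow> ('a \<Rightarrow> 'a \<Rightarrow> 'a) \<Rightarrow> ('a \<Rightarrow> 'a)
   \<Rightarrow> ('a list \<Rightarrow> 'v) \<Rightarrow> 'a list \<Rightarrow> 'v" where
  "bracket_sum scale_v bracket twist f xs =
     (\<Sum>j<length xs. \<Sum>i<j.
        scale_v ((- 1) ^ (i + j)) (f (bracket (xs ! i) (xs ! j) # map twist (nths xs (- {i, j})))))"

definition hom_lie_coboundary ::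
  "('a \<Rightarrow> 'a \<Rightarrow> 'a) \<Rightarrow> ('a \<Rightarrow> 'a) \<Rightarrow> ('k::field \<Rightarrow> 'v::ab_group_add \<Rightarrow> 'v) \<Rightarrow> ('a \<Rightarrow> 'v \<Rightarrow> 'v)
   \<Rightarrow> nat \<Rightarrow> ('a list \<Rightarrow> 'v) \<Rightarrow> 'a list \<Rightarrow> 'v" where
  "hom_lie_coboundary bracket \<alpha> scale_v act n f xs =
     (if length xs \<noteq> n + 1 then 0
      else if n = 0 then act (xs ! 0) (f [])
      else (\<Sum>i<n + 1. scale_v ((- 1) ^ i) (act ((\<alpha> ^^ (n - 1)) (xs ! i)) (f (nths xs (- {i})))))
           + bracket_sum scale_v bracket \<alpha> f xs)"


section \<open>The complex of a relative Rota--Baxter operator\<close>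

definition shuffles_perm :: "nat \<Rightarrow> nat \<Rightarrow> (nat \<Rightarrow> nat) set" where
  "shuffles_perm m n =
     {\<sigma>. \<sigma> permutes {..<m + n} \<and> strict_mono_on {..<m} \<sigma> \<and> strict_mono_on {m..<m + n} \<sigma>}"

text \<open>In the next two definitions \<open>m\<close> and \<open>n\<close> are the degrees of \<open>f\<close> and \<open>P\<close>,
  respectively \<open>P\<close> and \<open>Q\<close>; all of them are used only for degrees at least \<open>1\<close>.\<close>

definition insertion ::
  "('k::field \<Rightarrow> 'g::ab_group_add \<Rightarrow> 'g) \<Rightarrow> ('h \<Rightarrow> 'h) \<Rightarrow> nat \<Rightarrow> nat
   \<Rightarrow> ('h list \<Rightarrow> 'h) \<Rightarrow> ('h list \<Rightarrow> 'g) \<Rightarrow> 'h list \<Rightarrow> 'g" where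
  "insertion scale_g \<beta> m n f P hs =
     (if length hs \<noteq> m + n - 1 then 0
      else \<Sum>\<sigma>\<in>shuffles_perm m (n - 1). scale_g (of_int (sign \<sigma>))
             (P (f (map (\<lambda>k. hs ! \<sigma> k) [0..<m]) #
                 map (\<lambda>k. (\<beta> ^^ (m - 1)) (hs ! \<sigma> k)) [m..<m + n - 1])))"

definition cup_bracket ::
  "('k::field \<Rightarrow> 'g::ab_group_add \<Rightarrow> 'g) \<Rightarrow> ('g \<Rightarrow> 'g \<Rightarrow> 'g) \<Rightarrow> ('g \<Rightarrow> 'g) \<Rightarrow> nat \<Rightarrow> nat
   \<Rightarrow> ('h list \<Rightarrow> 'g) \<Rightarrow> ('h list \<Rightarrow> 'g) \<Rightarrow> 'h list \<Rightarrow> 'g" where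
  "cup_bracket scale_g bracket_g \<alpha> m n P Q hs =
     (if length hs \<noteq> m + n then 0
      else \<Sum>\<sigma>\<in>shuffles_perm m n. scale_g (of_int (sign \<sigma>))
             (bracket_g ((\<alpha> ^^ (n - 1)) (P (map (\<lambda>k. hs ! \<sigma> k) [0..<m])))
                        ((\<alpha> ^^ (m - 1)) (Q (map (\<lambda>k. hs ! \<sigma> k) [m..<m + n])))))"

definition theta ::
  "('k::field \<Rightarrow> 'h::ab_group_add \<Rightarrow> 'h) \<Rightarrow> ('h \<Rightarrow> 'h) \<Rightarrow> ('g \<Rightarrow> 'h \<Rightarrow> 'h) \<Rightarrow> nat
   \<Rightarrow> ('h list \<Rightarrow> 'g) \<Rightarrow> 'h list \<Rightarrow> 'h" where
  "theta scale_h \<beta> act n P hs =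
     (if length hs \<noteq> n + 1 then 0
      else \<Sum>i<n + 1. scale_h ((- 1) ^ (n + (i + 1)))
             (act (P (nths hs (- {i}))) ((\<beta> ^^ (n - 1)) (hs ! i))))"

definition derived_bracket ::
  "('k::field \<Rightarrow> 'g::ab_group_add \<Rightarrow> 'g) \<Rightarrow> ('g \<Rightarrow> 'g \<Rightarrow> 'g) \<Rightarrow> ('g \<Rightarrow> 'g) \<Rightarrow>
   ('k \<Rightarrow> 'h::ab_group_add \<Rightarrow> 'h) \<Rightarrow> ('h \<Rightarrow> 'h) \<Rightarrow> ('g \<Rightarrow> 'h \<Rightarrow> 'h) \<Rightarrow> nat \<Rightarrow> nat
   \<Rightarrow> ('h list \<Rightarrow> 'g) \<Rightarrow> ('h list \<Rightarrow> 'g) \<Rightarrow> 'h list \<Rightarrow> 'g" where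
  "derived_bracket scale_g bracket_g \<alpha> scale_h \<beta> act m n P Q hs =
     cup_bracket scale_g bracket_g \<alpha> m n P Q hs
     + insertion scale_g \<beta> (m + 1) n (theta scale_h \<beta> act m P) Q hs
     - scale_g ((- 1) ^ (m * n)) (insertion scale_g \<beta> (n + 1) m (theta scale_h \<beta> act n Q) P hs)"

definition d_weight ::
  "('k::field \<Rightarrow> 'g::ab_group_add \<Rightarrow> 'g) \<Rightarrow> ('h \<Rightarrow> 'h \<Rightarrow> 'h) \<Rightarrow> ('h \<Rightarrow> 'h) \<Rightarrow> 'k \<Rightarrow> nat
   \<Rightarrow> ('h list \<Rightarrow> 'g) \<Rightarrow> 'h list \<Rightarrow> 'g" where
  "d_weight scale_g bracket_h \<beta> lam n f hs =
     (if length hs \<noteq> n + 1 then 0 else scale_g lam (bracket_sum scale_g bracket_h \<beta> f hs))"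

definition one_cochain :: "('h \<Rightarrow> 'g::zero) \<Rightarrow> 'h list \<Rightarrow> 'g" where
  "one_cochain R hs = (if length hs = 1 then R (hs ! 0) else 0)"

definition rota_baxter_coboundary ::
  "('k::field \<Rightarrow> 'g::ab_group_add \<Rightarrow> 'g) \<Rightarrow> ('g \<Rightarrow> 'g \<Rightarrow> 'g) \<Rightarrow> ('g \<Rightarrow> 'g) \<Rightarrow>
   ('k \<Rightarrow> 'h::ab_group_add \<Rightarrow> 'h) \<Rightarrow> ('h \<Rightarrow> 'h \<Rightarrow> 'h) \<Rightarrow> ('h \<Rightarrow> 'h) \<Rightarrow> ('g \<Rightarrow> 'h \<Rightarrow> 'h) \<Rightarrow>
   'k \<Rightarrow> ('h \<Rightarrow> 'g) \<Rightarrow> nat \<Rightarrow> ('h list \<Rightarrow> 'g) \<Rightarrow> 'h list \<Rightarrow> 'g" where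
  "rota_baxter_coboundary scale_g bracket_g \<alpha> scale_h bracket_h \<beta> act lam R n f hs =
     (if n = 0
      then one_cochain (\<lambda>h. bracket_g (R h) (f []) + R (act (f []) h)) hs
      else d_weight scale_g bracket_h \<beta> lam n f hs
           + derived_bracket scale_g bracket_g \<alpha> scale_h \<beta> act 1 n (one_cochain R) f hs)"


section \<open>Cohomology\<close>

text \<open>A complex is given by its cochain spaces \<open>C n\<close> and differentials
  \<open>d n\<close> from degree \<open>n\<close> to degree \<open>n + 1\<close>, with pointwise vector space operations.\<close>

definition cocycle_group ::
  "(nat \<Rightarrow> ('a \<Rightarrow> 'v::ab_group_add) set) \<Rightarrow> (nat \<Rightarrow> ('a \<Rightarrow> 'v) \<Rightarrow> 'a \<Rightarrow> 'v) \<Rightarrow> nat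
   \<Rightarrow> ('a \<Rightarrow> 'v) monoid" where
  "cocycle_group C d n =
     \<lparr>carrier = {f \<in> C n. d n f = (\<lambda>_. 0)}, monoid.mult = (\<lambda>f g x. f x + g x), one = (\<lambda>_. 0)\<rparr>"

definition coboundaries ::
  "(nat \<Rightarrow> ('a \<Rightarrow> 'v::ab_group_add) set) \<Rightarrow> (nat \<Rightarrow> ('a \<Rightarrow> 'v) \<Rightarrow> 'a \<Rightarrow> 'v) \<Rightarrow> nat
   \<Rightarrow> ('a \<Rightarrow> 'v) set" where
  "coboundaries C d n = (case n of 0 \<Rightarrow> {\<lambda>_. 0} | Suc m \<Rightarrow> d m ` C m)"

definition cohomology_group ::
  "(nat \<Rightarrow> ('a \<Rightarrow> 'v::ab_group_add) set) \<Rightarrow> (nat \<Rightarrow> ('a \<Rightarrow> 'v) \<Rightarrow> 'a \<Rightarrow> 'v) \<Rightarrow> nat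
   \<Rightarrow> ('a \<Rightarrow> 'v) set monoid" where
  "cohomology_group C d n = cocycle_group C d n Mod coboundaries C d n"

text \<open>The scalar action \<open>c [f] = [c f]\<close>, as a union over representatives.\<close>

definition class_scale ::
  "(nat \<Rightarrow> ('a \<Rightarrow> 'v::ab_group_add) set) \<Rightarrow> (nat \<Rightarrow> ('a \<Rightarrow> 'v) \<Rightarrow> 'a \<Rightarrow> 'v) \<Rightarrow> nat
   \<Rightarrow> ('k \<Rightarrow> 'v \<Rightarrow> 'v) \<Rightarrow> 'k \<Rightarrow> ('a \<Rightarrow> 'v) set \<Rightarrow> ('a \<Rightarrow> 'v) set" where
  "class_scale C d n scale c A =
     (\<Union>f\<in>A. coboundaries C d n #>\<^bsub>cocycle_group C d n\<^esub> (\<lambda>x. scale c (f x)))"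

definition cohomology_isomorphic ::
  "('k \<Rightarrow> 'v::ab_group_add \<Rightarrow> 'v) \<Rightarrow> (nat \<Rightarrow> ('a \<Rightarrow> 'v) set) \<Rightarrow>
   (nat \<Rightarrow> ('a \<Rightarrow> 'v) \<Rightarrow> 'a \<Rightarrow> 'v) \<Rightarrow> ('k \<Rightarrow> 'w::ab_group_add \<Rightarrow> 'w) \<Rightarrow>
   (nat \<Rightarrow> ('b \<Rightarrow> 'w) set) \<Rightarrow> (nat \<Rightarrow> ('b \<Rightarrow> 'w) \<Rightarrow> 'b \<Rightarrow> 'w) \<Rightarrow> nat \<Rightarrow> bool" where
  "cohomology_isomorphic scale C d scale' C' d' n \<longleftrightarrow>
     (\<exists>\<phi> \<in> iso (cohomology_group C d n) (cohomology_group C' d' n).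
        \<forall>c. \<forall>A \<in> carrier (cohomology_group C d n).
          \<phi> (class_scale C d n scale c A) = class_scale C' d' n scale' c (\<phi> A))"

end

theory Submission
  imports Defs
begin

text \<open>
  Write $[h,k]^R$ for the induced bracket.  Two facts together give the proposition.

  First, $R$ sends $[h,k]^R$ to $[R h, R k]$; this is exactly the Rota--Baxter identity.  With it,
  the Hom-Jacobi identity of $[h,k]^R$ splits by powers of $\lambda$: the part of degree $0$ cancels
  because $\mathfrak{h}$ is a representation of $\mathfrak{g}$, the part of degree $1$ because
  $\mathfrak{g}$ acts by derivations, and the part of degree $2$ is the Hom-Jacobi identity of
  $\mathfrak{h}$.  In the representation axiom for the induced action, the Rota--Baxter identity
  rewrites $[R \beta h, R(x \diamond k)]$ as a value of $R$; the terms then left without an outer $R$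
  form the Hom-Jacobi identity of $\mathfrak{g}$, and those under $R$ cancel by the representation and
  derivation identities.

  Second, the two complexes do not merely have isomorphic cohomology: they have the same cochain
  spaces, and their differentials agree on every cochain, with no sign in between
  (\<open>coboundaries_agree\<close>).  In degree $0$ both are $x \mapsto (h \mapsto h \mathbin{\widetilde\diamond} x)$.
  In degree $n \ge 1$ the operator $[R,f]^\sim_D + \widetilde d_\lambda f$ has
  four constituents, and each matches a part of $\delta_{Hom} f$.  The first is a sum over
  $(1,n)$-shuffles of terms $[R(\beta^{n-1} h_i), f(\ldots)]$; the term with $\theta f$ has a single
  shuffle and contributes $R(f(\ldots) \diamond \beta^{n-1} h_i)$; together they are the induced action.
  The term with $\theta R$ is a sum over $(2,n-1)$-shuffles which produces
  $f(R h_i \diamond h_j - R h_j \diamond h_i, \ldots)$, and $\widetilde d_\lambda$ adds the missing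
  $f(\lambda [h_i,h_j], \ldots)$, so that together they are the bracket sum for $[h,k]^R$.  The
  isomorphism on cohomology is therefore the identity.

  What this comparison needs from combinatorics is that a $(1,n)$-shuffle is the same as an index
  $i$, with sign $(-1)^i$, and a $(2,n)$-shuffle is the same as a pair $i < j$, with sign
  $(-1)^{i+j+1}$, counting positions from $0$.
\<close>

section \<open>Shuffles with a short first block\<close>

text \<open>A shuffle is increasing on its second block, so it lists there the values that the first
  block leaves over, in their natural order.\<close>

lemma map_shuffle_second_block:
  assumes "\<sigma> \<in> shuffles_perm m n"
  shows "map \<sigma> [m..<m + n] = filter (\<lambda>k. k \<notin> \<sigma> ` {..<m}) [0..<m + n]"
proof (rule strict_sorted_equal)
  have perm: "\<sigma> permutes {..<m + n}" and mono: "strict_mono_on {m..<m + n} \<sigma>"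
    using assms by (auto simp: shuffles_perm_def)
  show "sorted_wrt (<) (filter (\<lambda>k. k \<notin> \<sigma> ` {..<m}) [0..<m + n])"
    by (intro sorted_wrt_filter sorted_wrt_upt)
  show "sorted_wrt (<) (map \<sigma> [m..<m + n])"
    unfolding sorted_wrt_map
    by (rule sorted_wrt_mono_rel[OF _ sorted_wrt_upt]) (use mono in \<open>auto simp: strict_mono_on_def\<close>)
  have "{m..<m + n} = {..<m + n} - {..<m}"
    by auto
  then have "\<sigma> ` {m..<m + n} = {..<m + n} - \<sigma> ` {..<m}"
    using permutes_image[OF perm] permutes_inj[OF perm] by (simp only: image_set_diff)
  then show "set (map \<sigma> [m..<m + n]) = set (filter (\<lambda>k. k \<notin> \<sigma> ` {..<m}) [0..<m + n])"
    by auto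
qed

lemma nths_conv_map_nth:
  "nths xs A = map ((!) xs) (filter (\<lambda>i. i \<in> A) [0..<length xs])"
proof -
  have "zip xs [0..<length xs] = map (\<lambda>i. (xs ! i, i)) [0..<length xs]"
    by (rule nth_equalityI) auto
  then show ?thesis
    by (simp add: nths_def filter_map o_def)
qed

lemma nth_shuffle_second_block:
  assumes "\<sigma> \<in> shuffles_perm m n" "length xs = m + n"
  shows "map (\<lambda>k. xs ! \<sigma> k) [m..<m + n] = nths xs (- \<sigma> ` {..<m})"
proof -
  have "map (\<lambda>k. xs ! \<sigma> k) [m..<m + n] = map ((!) xs) (map \<sigma> [m..<m + n])"
    by simp
  then show ?thesis
    using assms by (simp only: map_shuffle_second_block nths_conv_map_nth) simp
qed

lemma shuffle_eqI:
  assumes "\<sigma> \<in> shuffles_perm m n" "\<tau> \<in> shuffles_perm m n"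
    and "\<And>k. k < m \<Longrightarrow> \<sigma> k = \<tau> k"
  shows "\<sigma> = \<tau>"
proof
  fix k
  have "\<sigma> ` {..<m} = \<tau> ` {..<m}"
    using assms(3) by (auto intro!: image_cong)
  then have tail: "map \<sigma> [m..<m + n] = map \<tau> [m..<m + n]"
    using assms(1,2) by (simp only: map_shuffle_second_block)
  consider "k < m" | "k \<in> {m..<m + n}" | "k \<notin> {..<m + n}"
    by fastforce
  then show "\<sigma> k = \<tau> k"
  proof cases
    case 2
    then show ?thesis using tail by auto
  next
    case 3
    then show ?thesis
      using assms(1,2) permutes_not_in unfolding shuffles_perm_def by (metis (lifting) mem_Collect_eq)
  qed (use assms(3) in auto)
qed

text \<open>The cycle that moves \<open>i\<close> to the front and shifts \<open>0, \<dots>, i - 1\<close> up by one place.  Building it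
  from adjacent transpositions makes its sign evident.\<close>

primrec front_cycle :: "nat \<Rightarrow> nat \<Rightarrow> nat" where
  "front_cycle 0 = id"
| "front_cycle (Suc i) = transpose i (Suc i) \<circ> front_cycle i"

lemma front_cycle_apply:
  "front_cycle i k = (if k = 0 then i else if k \<le> i then k - 1 else k)"
  by (induction i) (auto simp: transpose_def)

lemma front_cycle_permutes: "i < n \<Longrightarrow> front_cycle i permutes {..<n}"
  by (induction i) (auto intro!: permutes_compose permutes_swap_id simp: permutes_id)

lemma permutation_front_cycle: "permutation (front_cycle i)"
  using front_cycle_permutes[of i "Suc i"] permutation_permutes by blast

lemma sign_front_cycle: "sign (front_cycle i) = (- 1) ^ i"
proof (induction i)
  case (Suc i)
  then show ?case
    by (simp only: front_cycle.simps sign_compose[OF permutation_swap_id permutation_front_cycle])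
      (simp add: sign_swap_id)
qed simp

(* Unfolding the recursion inside a composition would hide the closed form front_cycle_apply. *)
declare front_cycle.simps [simp del]

lemma front_cycle_shuffle: "i < n + 1 \<Longrightarrow> front_cycle i \<in> shuffles_perm 1 n"
  using front_cycle_permutes[of i "1 + n"]
  by (auto simp: shuffles_perm_def strict_mono_on_def front_cycle_apply)

text \<open>Since \<open>i < j\<close>, the first factor to act brings the positions \<open>0, 1\<close> to \<open>i + 1, 0\<close>, and the second
  brings these to \<open>i, j\<close>.\<close>

lemma front_cycle_pair_apply:
  assumes "i < j"
  shows "(front_cycle j \<circ> front_cycle (Suc i)) k =
    (if k = 0 then i else if k = 1 then j else if k \<le> i + 1 then k - 2 else if k \<le> j then k - 1 else k)"
  using assms by (auto simp: front_cycle_apply)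

lemma front_cycle_pair_shuffle:
  assumes "i < j" "j < n + 2"
  shows "front_cycle j \<circ> front_cycle (Suc i) \<in> shuffles_perm 2 n"
proof -
  have "front_cycle j \<circ> front_cycle (Suc i) permutes {..<2 + n}"
    using assms by (intro permutes_compose front_cycle_permutes) auto
  then show ?thesis
    using assms by (auto simp: shuffles_perm_def strict_mono_on_def front_cycle_pair_apply simp del: o_apply)
qed

lemma sign_front_cycle_pair: "sign (front_cycle j \<circ> front_cycle (Suc i)) = (- 1) ^ (i + j + 1)"
  by (simp add: sign_compose permutation_front_cycle sign_front_cycle power_add)

lemma shuffles_perm_0: "shuffles_perm m 0 = {id}"
proof -
  have id: "id \<in> shuffles_perm m 0"
    by (simp add: shuffles_perm_def permutes_id strict_mono_on_def)
  have "\<sigma> = id" if "\<sigma> \<in> shuffles_perm m 0" for \<sigma>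
  proof -
    have perm: "\<sigma> permutes {..<m}" and mono: "strict_mono_on {..<m} \<sigma>"
      using that by (auto simp: shuffles_perm_def)
    have "map \<sigma> [0..<m] = [0..<m]"
    proof (rule strict_sorted_equal)
      show "sorted_wrt (<) [0..<m]"
        by (rule sorted_wrt_upt)
      show "sorted_wrt (<) (map \<sigma> [0..<m])"
        unfolding sorted_wrt_map
        by (rule sorted_wrt_mono_rel[OF _ sorted_wrt_upt]) (use mono in \<open>auto simp: strict_mono_on_def\<close>)
      show "set (map \<sigma> [0..<m]) = set [0..<m]"
        using permutes_image[OF perm] by (simp add: lessThan_atLeast0)
    qed
    then have "map \<sigma> [0..<m] = map id [0..<m]"
      by simp
    then have "\<And>k. k < m \<Longrightarrow> \<sigma> k = id k"
      by (simp only: map_eq_conv) simp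
    then show ?thesis
      by (rule shuffle_eqI[OF that id])
  qed
  with id show ?thesis
    by blast
qed

text \<open>These two reindexings turn the sums over shuffles in the derived bracket into the sums over
  omitted positions in the Hom-Lie coboundary.\<close>

lemma sum_shuffles_1:
  fixes scale :: "'k::comm_ring_1 \<Rightarrow> 'v \<Rightarrow> 'v::comm_monoid_add"
  assumes "length xs = n + 1"
  shows "(\<Sum>\<sigma>\<in>shuffles_perm 1 n. scale (of_int (sign \<sigma>))
            (g (map (\<lambda>k. xs ! \<sigma> k) [0..<1]) (map (\<lambda>k. xs ! \<sigma> k) [1..<1 + n])))
       = (\<Sum>i<n + 1. scale ((- 1) ^ i) (g [xs ! i] (nths xs (- {i}))))"
proof (rule sum.reindex_bij_witness[where i = front_cycle and j = "\<lambda>\<sigma>. \<sigma> 0"])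
  fix \<sigma> assume \<sigma>: "\<sigma> \<in> shuffles_perm 1 n"
  then have "\<sigma> permutes {..<1 + n}"
    by (simp add: shuffles_perm_def)
  then have bound: "\<sigma> 0 < n + 1"
    using permutes_in_image[of \<sigma> "{..<1 + n}" 0] by simp
  then show "\<sigma> 0 \<in> {..<n + 1}"
    by simp
  show eq: "front_cycle (\<sigma> 0) = \<sigma>"
    by (rule shuffle_eqI[OF front_cycle_shuffle[OF bound] \<sigma>]) (simp add: front_cycle_apply)
  have "sign \<sigma> = (- 1) ^ \<sigma> 0"
    using sign_front_cycle[of "\<sigma> 0"] by (simp only: eq)
  moreover have "map (\<lambda>k. xs ! \<sigma> k) [1..<1 + n] = nths xs (- {\<sigma> 0})"
    using nth_shuffle_second_block[OF \<sigma>, of xs] assms by (simp add: lessThan_Suc)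
  ultimately show "scale ((- 1) ^ \<sigma> 0) (g [xs ! \<sigma> 0] (nths xs (- {\<sigma> 0})))
      = scale (of_int (sign \<sigma>)) (g (map (\<lambda>k. xs ! \<sigma> k) [0..<1]) (map (\<lambda>k. xs ! \<sigma> k) [1..<1 + n]))"
    by simp
next
  fix i assume "i \<in> {..<n + 1}"
  then show "front_cycle i \<in> shuffles_perm 1 n" "front_cycle i 0 = i"
    by (simp_all add: front_cycle_shuffle[simplified] front_cycle_apply)
qed

lemma sum_shuffles_2:
  fixes scale :: "'k::comm_ring_1 \<Rightarrow> 'v \<Rightarrow> 'v::comm_monoid_add"
  assumes "length xs = n + 2"
  shows "(\<Sum>\<sigma>\<in>shuffles_perm 2 n. scale (of_int (sign \<sigma>))
            (g (map (\<lambda>k. xs ! \<sigma> k) [0..<2]) (map (\<lambda>k. xs ! \<sigma> k) [2..<2 + n])))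
       = (\<Sum>j<n + 2. \<Sum>i<j. scale ((- 1) ^ (i + j + 1)) (g [xs ! i, xs ! j] (nths xs (- {i, j}))))"
proof -
  let ?pairs = "SIGMA j:{..<n + 2}. {..<j}"
  have "(\<Sum>\<sigma>\<in>shuffles_perm 2 n. scale (of_int (sign \<sigma>))
            (g (map (\<lambda>k. xs ! \<sigma> k) [0..<2]) (map (\<lambda>k. xs ! \<sigma> k) [2..<2 + n])))
      = (\<Sum>(j, i)\<in>?pairs. scale ((- 1) ^ (i + j + 1)) (g [xs ! i, xs ! j] (nths xs (- {i, j}))))"
  proof (rule sum.reindex_bij_witness[where i = "\<lambda>(j, i). front_cycle j \<circ> front_cycle (Suc i)"
          and j = "\<lambda>\<sigma>. (\<sigma> 1, \<sigma> 0)"])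
    fix \<sigma> assume \<sigma>: "\<sigma> \<in> shuffles_perm 2 n"
    then have "\<sigma> permutes {..<2 + n}" and less: "\<sigma> 0 < \<sigma> 1"
      by (simp_all add: shuffles_perm_def strict_mono_on_def)
    then have bound: "\<sigma> 1 < n + 2"
      using permutes_in_image[of \<sigma> "{..<2 + n}" 1] by simp
    with less show "(\<sigma> 1, \<sigma> 0) \<in> ?pairs"
      by simp
    have eq: "front_cycle (\<sigma> 1) \<circ> front_cycle (Suc (\<sigma> 0)) = \<sigma>"
      by (rule shuffle_eqI[OF front_cycle_pair_shuffle[OF less bound] \<sigma>])
        (use less in \<open>auto simp: front_cycle_pair_apply less_2_cases_iff simp del: o_apply\<close>)
    then show "(case (\<sigma> 1, \<sigma> 0) of (j, i) \<Rightarrow> front_cycle j \<circ> front_cycle (Suc i)) = \<sigma>"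
      by simp
    have "sign \<sigma> = (- 1) ^ (\<sigma> 0 + \<sigma> 1 + 1)"
      using sign_front_cycle_pair[of "\<sigma> 1" "\<sigma> 0"] by (simp only: eq)
    moreover have "map (\<lambda>k. xs ! \<sigma> k) [2..<2 + n] = nths xs (- {\<sigma> 0, \<sigma> 1})"
    proof -
      have "{..<2} = {0, 1::nat}"
        by auto
      then show ?thesis
        using nth_shuffle_second_block[OF \<sigma>, of xs] assms by simp
    qed
    moreover have "map (\<lambda>k. xs ! \<sigma> k) [0..<2] = [xs ! \<sigma> 0, xs ! \<sigma> 1]"
      by (simp add: upt_rec)
    ultimately show "(case (\<sigma> 1, \<sigma> 0) of (j, i) \<Rightarrow>
          scale ((- 1) ^ (i + j + 1)) (g [xs ! i, xs ! j] (nths xs (- {i, j}))))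
        = scale (of_int (sign \<sigma>)) (g (map (\<lambda>k. xs ! \<sigma> k) [0..<2]) (map (\<lambda>k. xs ! \<sigma> k) [2..<2 + n]))"
      by simp
  next
    fix p assume "p \<in> ?pairs"
    then obtain i j where p: "p = (j, i)" "i < j" "j < n + 2"
      by auto
    then show "(case p of (j, i) \<Rightarrow> front_cycle j \<circ> front_cycle (Suc i)) \<in> shuffles_perm 2 n"
      using front_cycle_pair_shuffle by simp
    show "((case p of (j, i) \<Rightarrow> front_cycle j \<circ> front_cycle (Suc i)) 1,
        (case p of (j, i) \<Rightarrow> front_cycle j \<circ> front_cycle (Suc i)) 0) = p"
      using p by (simp add: front_cycle_pair_apply del: o_apply)
  qed
  then show ?thesis
    by (subst sum.Sigma[OF _ ballI]) (assumption | rule finite_lessThan)+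
qed

section \<open>The induced representation\<close>

lemma bilinear_mapD:
  assumes "bilinear_map sa sb sc f"
  shows "f (x + x') y = f x y + f x' y" "f (x - x') y = f x y - f x' y" "f (sa c x) y = sc c (f x y)"
    "f x (y + y') = f x y + f x y'" "f x (y - y') = f x y - f x y'" "f x (sb c y) = sc c (f x y)"
    "f x (- y) = - f x y"
proof -
  have 1: "module_hom sa sc (\<lambda>x. f x y)" for y
    using assms by (auto simp: bilinear_map_def Vector_Spaces.linear_iff_module_hom)
  have 2: "module_hom sb sc (f x)" for x
    using assms by (auto simp: bilinear_map_def Vector_Spaces.linear_iff_module_hom)
  show "f (x + x') y = f x y + f x' y" "f (x - x') y = f x y - f x' y" "f (sa c x) y = sc c (f x y)"
    using module_hom.add[OF 1] module_hom.diff[OF 1] module_hom.scale[OF 1] by auto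
  show "f x (y + y') = f x y + f x y'" "f x (y - y') = f x y - f x y'" "f x (sb c y) = sc c (f x y)"
    "f x (- y) = - f x y"
    using module_hom.add[OF 2] module_hom.diff[OF 2] module_hom.scale[OF 2]
      module_hom.neg[OF 2] by auto
qed

lemma linearD:
  assumes "Vector_Spaces.linear sa sb f"
  shows "f (x + y) = f x + f y" "f (x - y) = f x - f y" "f (sa c x) = sb c (f x)"
  using assms module_hom.add module_hom.diff module_hom.scale
  by (auto simp: Vector_Spaces.linear_iff_module_hom)

context relative_rota_baxter
begin

abbreviation bracket_R :: "'h \<Rightarrow> 'h \<Rightarrow> 'h" where
  "bracket_R \<equiv> induced_bracket scale_h bracket_h act lam R"

abbreviation act_R :: "'h \<Rightarrow> 'g \<Rightarrow> 'g" where
  "act_R \<equiv> induced_action bracket_g act R"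

lemmas linearities =
  bilinear_mapD[OF alg.bracket_bilinear] bilinear_mapD[OF target.bracket_bilinear]
  bilinear_mapD[OF act_bilinear] linearD[OF alg.twist_linear] linearD[OF twist_v_linear]
  linearD[OF R_linear]
  vec.scale_right_distrib vec.scale_right_diff_distrib
  alg.scale_right_distrib alg.scale_right_diff_distrib

lemma R_induced_bracket: "R (bracket_R h k) = bracket_g (R h) (R k)"
  by (simp add: R_bracket induced_bracket_def)

lemma induced_bracket_bilinear: "bilinear_map scale_h scale_h scale_h bracket_R"
  unfolding bilinear_map_def Vector_Spaces.linear_iff induced_bracket_def
  by (auto simp: linearities vec.vector_space_axioms vec.scale_left_commute algebra_simps)

lemma induced_action_bilinear: "bilinear_map scale_h scale_g scale_g act_R"
  unfolding bilinear_map_def Vector_Spaces.linear_iff induced_action_def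
  by (auto simp: linearities vec.vector_space_axioms alg.vector_space_axioms algebra_simps)

text \<open>The terms are sorted by their degree in \<open>lam\<close>.  Skew-symmetry moves the twisted argument of
  each bracket of degree one to the front, so that the cyclic sum of those terms cancels literally.\<close>

lemma nested_induced_bracket:
  "bracket_R (\<beta> h) (bracket_R k l) =
     (act (\<alpha> (R h)) (act (R k) l) - act (\<alpha> (R h)) (act (R l) k)
        - act (\<alpha> (R k)) (act (R l) h) + act (\<alpha> (R l)) (act (R k) h))
   + (scale_h lam (bracket_h (\<beta> k) (act (R h) l)) - scale_h lam (bracket_h (\<beta> l) (act (R h) k))
        + scale_h lam (bracket_h (\<beta> h) (act (R k) l)) - scale_h lam (bracket_h (\<beta> h) (act (R l) k)))
   + scale_h lam (scale_h lam (bracket_h (\<beta> h) (bracket_h k l)))"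
proof -
  have "bracket_R (\<beta> h) (bracket_R k l) =
      act (\<alpha> (R h)) (bracket_R k l) - act (bracket_g (R k) (R l)) (\<beta> h)
      + scale_h lam (bracket_h (\<beta> h) (bracket_R k l))"
    by (simp add: induced_bracket_def[of _ _ _ _ _ "\<beta> h"] R_induced_bracket R_twist)
  moreover have "act (\<alpha> (R h)) (bracket_h k l)
      = bracket_h (\<beta> k) (act (R h) l) - bracket_h (\<beta> l) (act (R h) k)"
    using act_bracket[of "R h" k l] target.bracket_skew[of "act (R h) k" "\<beta> l"] by simp
  ultimately show ?thesis
    by (simp add: bracket_act induced_bracket_def linearities algebra_simps)
qed

lemma induced_hom_lie_algebra: "hom_lie_algebra scale_h bracket_R \<beta>"
proof
  show "bilinear_map scale_h scale_h scale_h bracket_R"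
    by (rule induced_bracket_bilinear)
  show "bracket_R h k = - bracket_R k h" for h k
    using target.bracket_skew[of h k] by (simp add: induced_bracket_def)
  show "\<beta> (bracket_R h k) = bracket_R (\<beta> h) (\<beta> k)" for h k
    by (simp add: induced_bracket_def linearities twist_act target.twist_bracket R_twist)
  show "bracket_R (\<beta> h) (bracket_R k l) + bracket_R (\<beta> k) (bracket_R l h)
      + bracket_R (\<beta> l) (bracket_R h k) = 0" for h k l
  proof -
    have "scale_h lam (scale_h lam (bracket_h (\<beta> h) (bracket_h k l)))
        + scale_h lam (scale_h lam (bracket_h (\<beta> k) (bracket_h l h)))
        + scale_h lam (scale_h lam (bracket_h (\<beta> l) (bracket_h h k))) = 0"
      using target.hom_jacobi[of h k l]
      by (simp add: vec.scale_right_distrib[symmetric] del: vec.scale_scale)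
    then show ?thesis
      unfolding nested_induced_bracket by (simp add: algebra_simps)
  qed
qed (simp_all add: linearities)

lemma induced_representation:
  "hom_lie_representation scale_h bracket_R \<beta> scale_g act_R \<alpha>"
proof -
  interpret ind: hom_lie_algebra scale_h bracket_R \<beta>
    by (rule induced_hom_lie_algebra)
  show ?thesis
  proof
    show "bilinear_map scale_h scale_g scale_g act_R"
      by (rule induced_action_bilinear)
    show "\<alpha> (act_R h x) = act_R (\<beta> h) (\<alpha> x)" for h x
      by (simp add: induced_action_def linearities alg.twist_bracket R_twist twist_act)
    show "act_R (bracket_R h k) (\<alpha> x) = act_R (\<beta> h) (act_R k x) - act_R (\<beta> k) (act_R h x)" for h k x
    proof -
      \<comment> \<open>The Rota--Baxter identity for \<open>R (\<beta> h)\<close> and \<open>R (act x k)\<close> produces the term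
        \<open>R (act (R (act x k)) (\<beta> h))\<close>, which also arises from the nested \<open>R\<close> with opposite sign.\<close>
      have twice: "act_R (\<beta> h) (act_R k x) = bracket_g (\<alpha> (R h)) (bracket_g (R k) x)
          + R (act (\<alpha> (R h)) (act x k)) + R (scale_h lam (bracket_h (\<beta> h) (act x k)))
          + R (act (\<alpha> (R k)) (act x h)) - R (act (\<alpha> x) (act (R k) h))" for h k
        using R_bracket[of "\<beta> h" "act x k"]
        by (simp add: induced_action_def linearities bracket_act R_twist)
      have jacobi: "bracket_g (bracket_g (R h) (R k)) (\<alpha> x)
          = bracket_g (\<alpha> (R h)) (bracket_g (R k) x) - bracket_g (\<alpha> (R k)) (bracket_g (R h) x)"
      proof -
        have "bracket_g (\<alpha> (R k)) (bracket_g x (R h)) = - bracket_g (\<alpha> (R k)) (bracket_g (R h) x)"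
          using alg.bracket_skew[of x "R h"] by (simp add: linearities)
        then show ?thesis
          using alg.hom_jacobi[of "R h" "R k" x] alg.bracket_skew[of "\<alpha> x" "bracket_g (R h) (R k)"]
          by (simp add: algebra_simps)
      qed
      have derivation: "act (\<alpha> x) (bracket_h h k)
          = bracket_h (\<beta> h) (act x k) - bracket_h (\<beta> k) (act x h)"
        using act_bracket[of x h k] target.bracket_skew[of "act x h" "\<beta> k"] by simp
      have "act_R (bracket_R h k) (\<alpha> x) = bracket_g (bracket_g (R h) (R k)) (\<alpha> x)
          + R (act (\<alpha> x) (bracket_R h k))"
        by (simp add: induced_action_def R_induced_bracket)
      then show ?thesis
        unfolding twice jacobi
        by (simp add: induced_bracket_def linearities derivation algebra_simps)
    qed
  qed (simp_all add: linearities)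
qed

section \<open>Comparison of the two differentials\<close>

(* The sums over positions are compared summand by summand, so no last summand may be split off. *)
declare sum.lessThan_Suc [simp del]

text \<open>The two-argument brackets of \<open>theta R\<close> and of \<open>bracket_h\<close> add up to the induced
  bracket inside the first argument of \<open>f\<close>.  The sign of a \<open>(2, n - 1)\<close>-shuffle is opposite to
  that in a bracket sum, and so is the sign of \<open>theta R\<close>.\<close>

lemma bracket_sum_induced:
  assumes "alternating_multilinear scale_h scale_g n f" "n \<ge> 1" "length hs = n + 1"
  shows "d_weight scale_g bracket_h \<beta> lam n f hs
       + insertion scale_g \<beta> 2 n (theta scale_h \<beta> act 1 (one_cochain R)) f hs
       = bracket_sum scale_g bracket_R \<beta> f hs"
proof -
  obtain m where n: "n = Suc m"
    using assms(2) by (cases n) auto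
  have lin: "Vector_Spaces.linear scale_h scale_g (\<lambda>x. f (x # ys))" if "length ys = m" for ys
    using assms(1) that unfolding alternating_multilinear_def n
    by (auto dest!: spec[where x = "0 # ys"] spec[where x = 0])
  have theta_R: "theta scale_h \<beta> act 1 (one_cochain R) [h, k] = act (R k) h - act (R h) k" for h k
    by (simp add: theta_def one_cochain_def nths_Cons sum.lessThan_Suc)
  have term_eq: "scale_g ((- 1) ^ (i + j)) (f (bracket_R (hs ! i) (hs ! j) # ys))
      = scale_g lam (scale_g ((- 1) ^ (i + j)) (f (bracket_h (hs ! i) (hs ! j) # ys)))
      + scale_g ((- 1) ^ (i + j + 1)) (f (theta scale_h \<beta> act 1 (one_cochain R) [hs ! i, hs ! j] # ys))"
    if "length ys = m" for i j ys
    unfolding theta_R induced_bracket_def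
    by (simp add: linearD[OF lin[OF that]] alg.scale_right_distrib alg.scale_right_diff_distrib mult.commute)
  have len: "length (map \<beta> (nths hs (- {i, j}))) = m" if "i < j" "j < length hs" for i j
  proof -
    have "{k. k < length hs \<and> k \<in> - {i, j}} = {..<length hs} - {i, j}"
      by auto
    then show ?thesis
      using that assms(3) by (simp add: length_nths n card_Diff_subset)
  qed
  have "insertion scale_g \<beta> 2 n (theta scale_h \<beta> act 1 (one_cochain R)) f hs
      = (\<Sum>\<sigma>\<in>shuffles_perm 2 m. scale_g (of_int (sign \<sigma>))
          ((\<lambda>as bs. f (theta scale_h \<beta> act 1 (one_cochain R) as # map \<beta> bs))
            (map (\<lambda>k. hs ! \<sigma> k) [0..<2]) (map (\<lambda>k. hs ! \<sigma> k) [2..<2 + m])))"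
    using assms(3) by (simp add: insertion_def n o_def del: upt_Suc)
  also have "\<dots> = (\<Sum>j<m + 2. \<Sum>i<j. scale_g ((- 1) ^ (i + j + 1))
      (f (theta scale_h \<beta> act 1 (one_cochain R) [hs ! i, hs ! j] # map \<beta> (nths hs (- {i, j})))))"
    by (subst sum_shuffles_2) (use assms(3) n in auto)
  finally have insertion_part: "insertion scale_g \<beta> 2 n (theta scale_h \<beta> act 1 (one_cochain R)) f hs
      = \<dots>" .
  have weight_part: "d_weight scale_g bracket_h \<beta> lam n f hs
      = (\<Sum>j<m + 2. \<Sum>i<j. scale_g lam (scale_g ((- 1) ^ (i + j))
          (f (bracket_h (hs ! i) (hs ! j) # map \<beta> (nths hs (- {i, j}))))))"
    using assms(3) n by (simp add: d_weight_def bracket_sum_def alg.scale_sum_right del: alg.scale_scale)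
  have "length hs = m + 2"
    using assms(3) n by simp
  then show ?thesis
    unfolding insertion_part weight_part bracket_sum_def sum.distrib[symmetric]
    by (intro sum.cong refl) (use len term_eq in \<open>auto\<close>)
qed

lemma R_twist_funpow: "(\<alpha> ^^ m) (R h) = R ((\<beta> ^^ m) h)"
  by (induction m) (simp_all add: R_twist)

lemma cup_bracket_one_cochain:
  assumes "length hs = n + 1"
  shows "cup_bracket scale_g bracket_g \<alpha> 1 n (one_cochain R) f hs
       = (\<Sum>i<n + 1. scale_g ((- 1) ^ i) (bracket_g (R ((\<beta> ^^ (n - 1)) (hs ! i))) (f (nths hs (- {i})))))"
proof -
  have "cup_bracket scale_g bracket_g \<alpha> 1 n (one_cochain R) f hs
      = (\<Sum>\<sigma>\<in>shuffles_perm 1 n. scale_g (of_int (sign \<sigma>))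
          ((\<lambda>as bs. bracket_g ((\<alpha> ^^ (n - 1)) (one_cochain R as)) (f bs))
            (map (\<lambda>k. hs ! \<sigma> k) [0..<1]) (map (\<lambda>k. hs ! \<sigma> k) [1..<1 + n])))"
    using assms by (simp add: cup_bracket_def del: upt_Suc)
  also have "\<dots> = (\<Sum>i<n + 1. scale_g ((- 1) ^ i)
      (bracket_g ((\<alpha> ^^ (n - 1)) (one_cochain R [hs ! i])) (f (nths hs (- {i})))))"
    by (subst sum_shuffles_1) (use assms in auto)
  finally show ?thesis
    by (simp add: one_cochain_def R_twist_funpow)
qed

text \<open>The identity is the only \<open>(n + 1, 0)\<close>-shuffle, and the factor \<open>- (- 1) ^ n\<close> turns the
  sign \<open>(- 1) ^ (n + i + 1)\<close> of \<open>theta f\<close> into \<open>(- 1) ^ i\<close>.\<close>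

lemma insertion_theta_one_cochain:
  assumes "length hs = n + 1"
  shows "- scale_g ((- 1) ^ n) (insertion scale_g \<beta> (n + 1) 1 (theta scale_h \<beta> act n f) (one_cochain R) hs)
       = (\<Sum>i<n + 1. scale_g ((- 1) ^ i) (R (act (f (nths hs (- {i}))) ((\<beta> ^^ (n - 1)) (hs ! i)))))"
proof -
  interpret R: module_hom scale_h scale_g R
    using R_linear by (simp add: Vector_Spaces.linear_iff_module_hom)
  have hs: "map ((!) hs) [0..<Suc n] = hs"
    using map_nth[of hs] assms by simp
  have "insertion scale_g \<beta> (n + 1) 1 (theta scale_h \<beta> act n f) (one_cochain R) hs
      = R (theta scale_h \<beta> act n f hs)"
    using assms hs by (simp add: insertion_def shuffles_perm_0 one_cochain_def del: upt_Suc)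
  also have "\<dots> = (\<Sum>i<n + 1. scale_g ((- 1) ^ (n + (i + 1)))
      (R (act (f (nths hs (- {i}))) ((\<beta> ^^ (n - 1)) (hs ! i)))))"
    using assms by (simp add: theta_def R.sum R.scale R.neg)
  finally show ?thesis
    by (simp add: alg.scale_sum_right sum_negf[symmetric] power_add flip: mult.assoc)
qed

text \<open>In positive degree the cup bracket and the term with \<open>theta f\<close> add up to the two summands of
  the induced action, and the remaining two terms to the bracket sum.  The latter uses that a
  cochain is linear in its first argument, and hence needs \<open>f\<close> to be one.\<close>

lemma coboundaries_agree:
  assumes "f \<in> hom_cochains scale_h \<beta> scale_g \<alpha> n"
  shows "hom_lie_coboundary bracket_R \<beta> scale_g act_R n f
       = rota_baxter_coboundary scale_g bracket_g \<alpha> scale_h bracket_h \<beta> act lam R n f"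
proof
  fix hs :: "'h list"
  consider "n = 0" | "n \<ge> 1" "length hs \<noteq> n + 1" | "n \<ge> 1" "length hs = n + 1"
    by linarith
  then show "hom_lie_coboundary bracket_R \<beta> scale_g act_R n f hs
      = rota_baxter_coboundary scale_g bracket_g \<alpha> scale_h bracket_h \<beta> act lam R n f hs"
  proof cases
    case 1
    then show ?thesis
      by (simp add: hom_lie_coboundary_def rota_baxter_coboundary_def one_cochain_def induced_action_def)
  next
    case 2
    then show ?thesis
      by (simp add: hom_lie_coboundary_def rota_baxter_coboundary_def d_weight_def derived_bracket_def
          cup_bracket_def insertion_def)
  next
    case 3
    have "alternating_multilinear scale_h scale_g n f"
      using assms by (simp add: hom_cochains_def)
    note bracket_part = bracket_sum_induced[OF this 3]
    have "(\<Sum>i<n + 1. scale_g ((- 1) ^ i) (act_R ((\<beta> ^^ (n - 1)) (hs ! i)) (f (nths hs (- {i})))))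
        = cup_bracket scale_g bracket_g \<alpha> 1 n (one_cochain R) f hs
        - scale_g ((- 1) ^ n)
            (insertion scale_g \<beta> (n + 1) 1 (theta scale_h \<beta> act n f) (one_cochain R) hs)"
      unfolding diff_conv_add_uminus cup_bracket_one_cochain[OF 3(2)]
        insertion_theta_one_cochain[OF 3(2)] sum.distrib[symmetric]
      by (simp add: induced_action_def alg.scale_right_distrib)
    then show ?thesis
      using 3 bracket_part
      by (simp add: hom_lie_coboundary_def rota_baxter_coboundary_def derived_bracket_def
          one_add_one[symmetric] del: one_add_one)
  qed
qed

end

text \<open>All data entering the cohomology, including the scalar action, depend on a differential only
  through its restriction to the cochains; so the groups are equal and the identity serves.\<close>

lemma cohomology_isomorphic_if_differentials_agree:
  assumes "\<And>n f. f \<in> C n \<Longrightarrow> d n f = d' n f"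
  shows "cohomology_isomorphic scale C d scale C d' n"
proof -
  have cocycles: "cocycle_group C d n = cocycle_group C d' n"
    using assms by (auto simp: cocycle_group_def)
  have coboundaries: "coboundaries C d n = coboundaries C d' n"
    using assms by (auto simp: coboundaries_def split: nat.split)
  show ?thesis
    unfolding cohomology_isomorphic_def cohomology_group_def class_scale_def cocycles coboundaries
    by (rule bexI[OF _ iso_set_refl]) simp
qed

theorem proposition5p13:
  fixes scale_g :: "'k::field_char_0 \<Rightarrow> 'g::ab_group_add \<Rightarrow> 'g"
    and bracket_g :: "'g \<Rightarrow> 'g \<Rightarrow> 'g"
    and \<alpha> :: "'g \<Rightarrow> 'g"
    and scale_h :: "'k \<Rightarrow> 'h::ab_group_add \<Rightarrow> 'h"
    and bracket_h :: "'h \<Rightarrow> 'h \<Rightarrow> 'h"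
    and \<beta> :: "'h \<Rightarrow> 'h"
    and act :: "'g \<Rightarrow> 'h \<Rightarrow> 'h"
    and lam :: 'k
    and R :: "'h \<Rightarrow> 'g"
  assumes "hom_lie_algebra scale_g bracket_g \<alpha>"
    and "hom_lie_algebra scale_h bracket_h \<beta>"
    and "hom_lie_action scale_g bracket_g \<alpha> scale_h bracket_h \<beta> act"
    and "relative_rota_baxter scale_g bracket_g \<alpha> scale_h bracket_h \<beta> act lam R"
  shows "hom_lie_representation scale_h (induced_bracket scale_h bracket_h act lam R) \<beta>
           scale_g (induced_action bracket_g act R) \<alpha>
       \<and> (\<forall>n. cohomology_isomorphic
             scale_g
             (hom_cochains scale_h \<beta> scale_g \<alpha>)
             (hom_lie_coboundary (induced_bracket scale_h bracket_h act lam R) \<beta>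
                scale_g (induced_action bracket_g act R))
             scale_g
             (hom_cochains scale_h \<beta> scale_g \<alpha>)
             (rota_baxter_coboundary scale_g bracket_g \<alpha> scale_h bracket_h \<beta> act lam R)
             n)"
proof (intro conjI allI)
  interpret relative_rota_baxter scale_g bracket_g \<alpha> scale_h bracket_h \<beta> act lam R
    by fact
  show "hom_lie_representation scale_h bracket_R \<beta> scale_g act_R \<alpha>"
    by (rule induced_representation)
  show "cohomology_isomorphic scale_g (hom_cochains scale_h \<beta> scale_g \<alpha>)
      (hom_lie_coboundary bracket_R \<beta> scale_g act_R)
      scale_g (hom_cochains scale_h \<beta> scale_g \<alpha>)
      (rota_baxter_coboundary scale_g bracket_g \<alpha> scale_h bracket_h \<beta> act lam R) n" for n
    by (rule cohomology_isomorphic_if_differentials_agree) (rule coboundaries_agree)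
qed

end
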